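(* Let $\mathcal{S}_R,\mathcal{S}_P,\mathcal{S}_Q\in\mathcal{L}(n)$ with atoms $\{a_1\},\dots,\{a_n\}$, where $\mathcal{S}_R$ is super-atomic, $\mathcal{S}_Q\prec\mathcal{S}_P\le\mathcal{S}_R$ in $\mathcal{L}(n)$, and the labeling $\mathcal{C}_P$ of $\mathcal{S}_P$ is a strong coordinatization. Then the labeling $\mathcal{C}_Q$ of $\mathcal{S}_Q$ is a strong coordinatization if and only if $\triangle_Q(\{a_k\})=x_Q(\{a_k\})$ for every $k\in\{1,\dots,n\}$.
   Context: $\mathcal{L}(n)$ is the set of finite atomic lattices with $n$ labeled atoms, each represented as a family $\mathcal{S}_T$ of subsets of $\{a_1,\dots,a_n\}$ closed under intersection and containing $\emptyset$, $\{a_1,\dots,a_n\}$ and all singletons $\{a_i\}$, ordered by inclusion (joins are the smallest members containing the union). $\mathcal{L}(n)$ is partially ordered by: $\mathcal{S}_Q\le\mathcal{S}_P$ iff there is a join-preserving map $\mathcal{S}_P\to\mathcal{S}_Q$ which is a bijection on atoms respecting labels; $\prec$ denotes the covering relation. A finite atomic lattice is super-atomic if for every element $p$ that is neither the bottom nor an atom, and every set $T$ of atoms with $\bigvee T=p$, there exist exactly two elements $a,b\in T$ with $a\vee b=p$. For $\mathcal{S}_T\in\mathcal{L}(n)$ the labeling $\mathcal{C}_T$ assigns to each $C\in\mathcal{S}_T\setminus\{\emptyset\}$ the monomial $m_C=\prod_{a_i\in C}a_i$ in $K[a_1,\dots,a_n]$ ($K$ a field), and $m_\emptyset=1$. For an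 atom $\{a_i\}$ let $x_T(\{a_i\})=\prod_{C\in\mathcal{S}_T,\ \{a_i\}\not\subseteq C}m_C$, and let $C_{\mathcal{S}_T,\mathcal{C}_T}$ be the ideal generated by all $x_T(\{a_i\})$. For $D\in\mathcal{S}_T$ let $B_D$ be the set of sets $W$ of atoms contained in $D$ whose join in $\mathcal{S}_T$ is $D$, and let $\triangle_T(\{a_i\})=\gcd\{\mathrm{lcm}\{x_T(w):w\in W\}: W\in\bigcup_{D\supseteq\{a_i\}}B_D\}$ (with $\mathrm{lcm}\,\emptyset=\gcd\emptyset=1$). The lcm-lattice $LCM(I)$ of a monomial ideal is the set of least common multiples of subsets of its minimal generators, ordered by divisibility. $\mathcal{C}_T$ is a strong coordinatization of $\mathcal{S}_T$ if there is a lattice isomorphism $g:\mathcal{S}_T\to LCM(C_{\mathcal{S}_T,\mathcal{C}_T})$ with $g(\{a_i\})=x_T(\{a_i\})$ for all $i$. *)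

theory Defs
  imports Complex_Main "HOL-Library.Poly_Mapping"
begin

text \<open>
  The labels \<open>a\<^sub>1, \<dots>, a\<^sub>n\<close> are the elements of a finite type \<open>'a\<close>, so \<open>n = CARD('a)\<close>.
\<close>

section \<open>Finite atomic lattices with labeled atoms\<close>

definition atomic_lattices :: "'a::finite set set set" where
  "atomic_lattices = {S. {} \<in> S \<and> UNIV \<in> S \<and> (\<forall>a. {a} \<in> S) \<and> (\<forall>A\<in>S. \<forall>B\<in>S. A \<inter> B \<in> S)}"

definition Join :: "'a::finite set set \<Rightarrow> 'a set set \<Rightarrow> 'a set" where
  "Join S X = \<Inter>{C \<in> S. \<Union>X \<subseteq> C}"

definition join_preserving :: "'a::finite set set \<Rightarrow> 'a set set \<Rightarrow> ('a set \<Rightarrow> 'a set) \<Rightarrow> bool" where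
  "join_preserving S T f \<longleftrightarrow>
     f ` S \<subseteq> T \<and> (\<forall>A\<in>S. \<forall>B\<in>S. f (Join S {A, B}) = Join T {f A, f B})"

definition lattice_le :: "'a::finite set set \<Rightarrow> 'a set set \<Rightarrow> bool" where
  "lattice_le Q P \<longleftrightarrow> (\<exists>f. join_preserving P Q f \<and> (\<forall>a. f {a} = {a}))"

definition lattice_less :: "'a::finite set set \<Rightarrow> 'a set set \<Rightarrow> bool" where
  "lattice_less Q P \<longleftrightarrow> lattice_le Q P \<and> Q \<noteq> P"

definition lattice_covered :: "'a::finite set set \<Rightarrow> 'a set set \<Rightarrow> bool" where
  "lattice_covered Q P \<longleftrightarrow>
     lattice_less Q P \<and> \<not> (\<exists>T\<in>atomic_lattices. lattice_less Q T \<and> lattice_less T P)"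

text \<open>
  A set of atoms is given by its set of labels. The two elements \<open>a\<close>, \<open>b\<close> form an unordered
  pair, and ``exactly two'' says that \<open>W\<close> contains exactly one such pair.
\<close>

definition super_atomic :: "'a::finite set set \<Rightarrow> bool" where
  "super_atomic S \<longleftrightarrow>
     (\<forall>p\<in>S. p \<noteq> {} \<and> (\<forall>a. p \<noteq> {a}) \<longrightarrow>
       (\<forall>W. Join S ((\<lambda>w. {w}) ` W) = p \<longrightarrow>
         (\<exists>!E. \<exists>a\<in>W. \<exists>b\<in>W. a \<noteq> b \<and> E = {a, b} \<and> Join S {{a}, {b}} = p)))"

section \<open>Monomial ideals\<close>

text \<open>
  The polynomial ring over \<open>'k\<close> in the variables \<open>'a\<close>: finitely supported maps from exponent
  vectors to coefficients.
\<close>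

type_synonym ('a, 'k) mpoly = "('a \<Rightarrow>\<^sub>0 nat) \<Rightarrow>\<^sub>0 'k"

definition var :: "'a \<Rightarrow> ('a, 'k::field) mpoly" where
  "var a = Poly_Mapping.single (Poly_Mapping.single a 1) 1"

definition monomials :: "('a, 'k::field) mpoly set" where
  "monomials = range (\<lambda>t. Poly_Mapping.single t 1)"

text \<open>
  Least common multiples and greatest common divisors of sets of monomials are themselves taken to
  be monomials, hence unique and not just unique up to units. \<open>mlcm\<close> is meaningful for finite sets
  only, where it exists; \<open>mlcm {} = 1\<close> follows from the definition, \<open>mgcd {} = 1\<close> is a convention.
\<close>

definition mlcm :: "('a, 'k::field) mpoly set \<Rightarrow> ('a, 'k) mpoly" where
  "mlcm M = (THE m. m \<in> monomials \<and> (\<forall>p\<in>M. p dvd m) \<and>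
     (\<forall>m'\<in>monomials. (\<forall>p\<in>M. p dvd m') \<longrightarrow> m dvd m'))"

definition mgcd :: "('a, 'k::field) mpoly set \<Rightarrow> ('a, 'k) mpoly" where
  "mgcd M = (if M = {} then 1 else
     (THE m. m \<in> monomials \<and> (\<forall>p\<in>M. m dvd p) \<and>
       (\<forall>m'\<in>monomials. (\<forall>p\<in>M. m' dvd p) \<longrightarrow> m' dvd m)))"

text \<open>Ideals are the submodules of the ring as a module over itself.\<close>

definition ideal_generated :: "('a, 'k::field) mpoly set \<Rightarrow> ('a, 'k) mpoly set" where
  "ideal_generated X = module.span (*) X"

text \<open>
  The minimal generators of a monomial ideal: its unique irredundant generating set of monomials.
\<close>

definition minimal_generators :: "('a, 'k::field) mpoly set \<Rightarrow> ('a, 'k) mpoly set" where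
  "minimal_generators I = (THE G. G \<subseteq> monomials \<and> ideal_generated G = I \<and>
     (\<forall>H. H \<subset> G \<longrightarrow> ideal_generated H \<noteq> I))"

definition LCM_lattice :: "('a, 'k::field) mpoly set \<Rightarrow> ('a, 'k) mpoly set" where
  "LCM_lattice I = mlcm ` Pow (minimal_generators I)"

section \<open>The labeling and its coordinatization\<close>

definition label :: "'a::finite set \<Rightarrow> ('a, 'k::field) mpoly" where
  "label C = (\<Prod>a\<in>C. var a)"

definition x_mon :: "'a::finite set set \<Rightarrow> 'a \<Rightarrow> ('a, 'k::field) mpoly" where
  "x_mon S a = (\<Prod>C\<in>{C \<in> S. \<not> {a} \<subseteq> C}. label C)"

definition coord_ideal :: "'a::finite set set \<Rightarrow> ('a, 'k::field) mpoly set" where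
  "coord_ideal S = ideal_generated (range (x_mon S))"

definition join_sets :: "'a::finite set set \<Rightarrow> 'a set \<Rightarrow> 'a set set" where
  "join_sets S D = {W. W \<subseteq> D \<and> Join S ((\<lambda>w. {w}) ` W) = D}"

definition triangle :: "'a::finite set set \<Rightarrow> 'a \<Rightarrow> ('a, 'k::field) mpoly" where
  "triangle S a = mgcd ((\<lambda>W. mlcm (x_mon S ` W)) ` (\<Union>D\<in>{D \<in> S. {a} \<subseteq> D}. join_sets S D))"

text \<open>
  Both lattices are given by their orders, inclusion on \<open>S\<close> and divisibility on \<open>L\<close>, so a lattice
  isomorphism is an order isomorphism.
\<close>

definition lattice_iso ::
  "'a::finite set set \<Rightarrow> ('a, 'k::field) mpoly set \<Rightarrow> ('a set \<Rightarrow> ('a, 'k) mpoly) \<Rightarrow> bool" where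
  "lattice_iso S L g \<longleftrightarrow>
     bij_betw g S L \<and> (\<forall>A\<in>S. \<forall>B\<in>S. A \<subseteq> B \<longleftrightarrow> g A dvd g B)"

text \<open>The field of coefficients does not occur in \<open>S\<close>, hence the type argument.\<close>

definition strong_coordinatization :: "'k::field itself \<Rightarrow> 'a::finite set set \<Rightarrow> bool" where
  "strong_coordinatization _ S \<longleftrightarrow>
     (\<exists>g :: 'a set \<Rightarrow> ('a, 'k) mpoly.
        lattice_iso S (LCM_lattice (coord_ideal S)) g \<and> (\<forall>a. g {a} = x_mon S a))"

end

theory Submission
  imports Defs
begin

text \<open>
  The exponent of the variable \<open>v\<close> in \<open>x\<^sub>S(a)\<close> is the number of members of \<open>S\<close> that contain \<open>v\<close> but
  not \<open>a\<close>. Looking at \<open>v = b\<close> shows that the \<open>x\<^sub>S(a)\<close> form an antichain under divisibility, so they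
  are the minimal generators of the ideal and the lcm-lattice consists of the
  \<open>lcm {x\<^sub>S(w) | w \<in> W}\<close>. The condition \<open>\<triangle>\<^sub>S(a) = x\<^sub>S(a)\<close> says that \<open>x\<^sub>S(a)\<close> divides
  this lcm whenever \<open>a\<close> lies in the join of \<open>W\<close>, which any strong coordinatization satisfies.

  Conversely, this condition makes \<open>D \<mapsto> lcm {x\<^sub>S(w) | w \<in> D}\<close> a monotone surjection onto the
  lcm-lattice, and it remains to see that \<open>x\<^sub>Q(a)\<close> does not divide the image of \<open>D\<close> if \<open>a \<notin> D\<close>.
  Now \<open>Q \<subseteq> P \<subseteq> R\<close> as families of sets. In the super-atomic \<open>R\<close>, \<open>D\<close> is the join of two atoms
  \<open>p, q\<close>, and the join of \<open>p, q, a\<close> is that of two of these, one of them \<open>a\<close> and the other \<open>p\<close>, say.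
  Hence every member of \<open>Q\<close> containing \<open>p\<close> and \<open>a\<close> contains \<open>D\<close>, while \<open>D\<close> itself contains \<open>p\<close> but
  not \<open>a\<close>; so the exponent of \<open>p\<close> in \<open>x\<^sub>Q(a)\<close> exceeds that in every \<open>x\<^sub>Q(w)\<close> with \<open>w \<in> D\<close>.
\<close>

section \<open>Closure systems of sets of atoms\<close>

lemma Union_subset_Join: "\<Union>X \<subseteq> Join S X"
  unfolding Join_def by blast

lemma Join_subset_iff:
  assumes "C \<in> S"
  shows "Join S X \<subseteq> C \<longleftrightarrow> \<Union>X \<subseteq> C"
proof
  show "Join S X \<subseteq> C \<Longrightarrow> \<Union>X \<subseteq> C"
    using Union_subset_Join[of X S] by blast
  show "\<Union>X \<subseteq> C \<Longrightarrow> Join S X \<subseteq> C"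
    unfolding Join_def using assms by blast
qed

lemma Join_in:
  fixes S :: "'a::finite set set"
  assumes "S \<in> atomic_lattices"
  shows "Join S X \<in> S"
proof -
  have "\<Inter>T \<in> S" if "finite T" "T \<subseteq> S" for T
    using that assms
    by (induction T rule: finite_induct) (auto simp: atomic_lattices_def)
  then show ?thesis
    unfolding Join_def by auto
qed

lemma Join_eq_self:
  assumes "C \<in> S" "\<Union>X = C"
  shows "Join S X = C"
  using assms Join_subset_iff[of C S X] Union_subset_Join[of X S] by blast

text \<open>Joining is a closure operator. This builds joins of many atoms from the binary joins
  that \<open>join_preserving\<close> speaks about.\<close>

lemma Join_insert_Join: "Join S {A, Join S X} = Join S (insert A X)"
proof -
  have "{C \<in> S. \<Union>{A, Join S X} \<subseteq> C} = {C \<in> S. \<Union>(insert A X) \<subseteq> C}"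
    using Join_subset_iff[of _ S X] by auto
  then show ?thesis
    by (simp add: Join_def[of S "insert _ _"])
qed

text \<open>The map is monotone, fixes atoms and sends the \<open>P\<close>-join of the atoms of a
  nonempty \<open>C\<close> in \<open>Q\<close> into \<open>C\<close>. Hence every atom below that
  join already lies in \<open>C\<close>, so \<open>C\<close> is closed in \<open>P\<close>.\<close>

lemma lattice_le_imp_subset:
  fixes P Q :: "'a::finite set set"
  assumes P: "P \<in> atomic_lattices" and le: "lattice_le Q P"
  shows "Q \<subseteq> P"
proof
  fix C assume C: "C \<in> Q"
  obtain f where pres: "join_preserving P Q f" and atom: "\<And>a. f {a} = {a}"
    using le unfolding lattice_le_def by auto
  have join: "f (Join P {A, B}) = Join Q {f A, f B}" if "A \<in> P" "B \<in> P" for A B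
    using pres that unfolding join_preserving_def by simp
  have sing: "{a} \<in> P" for a
    using P by (simp add: atomic_lattices_def)
  have mono: "f A \<subseteq> f B" if "A \<in> P" "B \<in> P" "A \<subseteq> B" for A B
  proof -
    have "Join P {A, B} = B"
      using that by (intro Join_eq_self) auto
    then have "f B = Join Q {f A, f B}"
      using join that by metis
    then show ?thesis
      using Union_subset_Join[of "{f A, f B}" Q] by auto
  qed
  \<comment> \<open>Preservation is assumed for binary joins only, so the induction starts at one
    atom; empty \<open>C\<close> is treated separately below.\<close>
  have bound: "f (Join P ((\<lambda>w. {w}) ` X)) \<subseteq> C" if "finite X" "X \<noteq> {}" "X \<subseteq> C" for X
    using that
  proof (induction X rule: finite_ne_induct)
    case (singleton x)
    have "Join P {{x}} = {x}"
      using sing by (intro Join_eq_self) auto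
    then show ?case
      using atom singleton by simp
  next
    case (insert x X)
    let ?J = "Join P ((\<lambda>w. {w}) ` X)"
    have "f (Join P ((\<lambda>w. {w}) ` insert x X)) = f (Join P {{x}, ?J})"
      by (simp add: Join_insert_Join)
    also have "\<dots> = Join Q {{x}, f ?J}"
      using join[OF sing Join_in[OF P]] atom by simp
    also have "\<dots> \<subseteq> C"
      using insert C by (simp add: Join_subset_iff)
    finally show ?case .
  qed
  show "C \<in> P"
  proof (cases "C = {}")
    case True
    then show ?thesis
      using P by (simp add: atomic_lattices_def)
  next
    case False
    let ?J = "Join P ((\<lambda>w. {w}) ` C)"
    have "?J \<subseteq> C"
    proof
      fix b assume "b \<in> ?J"
      then have "f {b} \<subseteq> f ?J"
        by (intro mono sing Join_in[OF P]) auto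
      then show "b \<in> C"
        using bound[of C] False atom by auto
    qed
    moreover have "C \<subseteq> ?J"
      using Union_subset_Join[of "(\<lambda>w. {w}) ` C" P] by auto
    ultimately show ?thesis
      using Join_in[OF P] by (metis subset_antisym)
  qed
qed

text \<open>Supplies the variable \<open>p\<close> whose exponent will detect \<open>a\<close>. As
  the bound ranges over all members of \<open>R\<close>, it passes to any subfamily.\<close>

lemma super_atomic_separation:
  fixes R :: "'a::finite set set"
  assumes R: "R \<in> atomic_lattices" and sa: "super_atomic R"
    and D: "D \<in> R" "D \<noteq> {}" and a: "a \<notin> D"
  shows "\<exists>p\<in>D. \<forall>C\<in>R. p \<in> C \<and> a \<in> C \<longrightarrow> D \<subseteq> C"
proof (cases "\<exists>b. D = {b}")
  case True
  then show ?thesis by auto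
next
  case False
  have pair: "\<exists>c\<in>W. \<exists>d\<in>W. c \<noteq> d \<and> Join R {{c}, {d}} = E"
    if "E \<in> R" "E \<noteq> {}" "\<forall>b. E \<noteq> {b}" "Join R ((\<lambda>w. {w}) ` W) = E" for E W
  proof -
    have "\<exists>!F. \<exists>c\<in>W. \<exists>d\<in>W. c \<noteq> d \<and> F = {c, d} \<and> Join R {{c}, {d}} = E"
      using sa that unfolding super_atomic_def by simp
    then show ?thesis
      by auto
  qed
  have "Join R ((\<lambda>w. {w}) ` D) = D"
    using D by (intro Join_eq_self) auto
  then obtain p q where pq: "p \<in> D" "q \<in> D" "p \<noteq> q" "Join R {{p}, {q}} = D"
    using pair[of D D] D False by blast
  define E where "E = Join R ((\<lambda>w. {w}) ` {p, q, a})"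
  have E: "E \<in> R" "p \<in> E" "q \<in> E" "a \<in> E"
    using Join_in[OF R] Union_subset_Join[of "(\<lambda>w. {w}) ` {p, q, a}" R] by (auto simp: E_def)
  then obtain c d where cd: "c \<in> {p, q, a}" "d \<in> {p, q, a}" "c \<noteq> d" "Join R {{c}, {d}} = E"
    using pair[of E "{p, q, a}"] pq(3) E_def by blast
  \<comment> \<open>The join of \<open>p\<close> and \<open>q\<close> is \<open>D\<close>, which
    misses \<open>a\<close>, so the pair with join \<open>E\<close> must involve
    \<open>a\<close>.\<close>
  have "{c, d} \<noteq> {p, q}"
  proof
    assume "{c, d} = {p, q}"
    then have "{{c}, {d}} = {{p}, {q}}"
      by (auto simp: doubleton_eq_iff)
    then show False
      using cd(4) pq(4) E(4) a by simp
  qed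
  then obtain r where r: "r \<in> {p, q}" "{c, d} = {r, a}"
    using cd(1-3) by fastforce
  have rE: "Join R {{r}, {a}} = E"
  proof -
    have "{{c}, {d}} = {{r}, {a}}"
      using r(2) by (auto simp: doubleton_eq_iff)
    then show ?thesis
      using cd(4) by simp
  qed
  have "D \<subseteq> C" if "C \<in> R" "r \<in> C" "a \<in> C" for C
  proof -
    have "E \<subseteq> C"
      using Join_subset_iff[OF that(1), of "{{r}, {a}}"] that rE by simp
    then show ?thesis
      using Join_subset_iff[OF that(1), of "{{p}, {q}}"] pq(4) E by auto
  qed
  then show ?thesis
    using r(1) pq by blast
qed

section \<open>Monomials\<close>

definition monom :: "('a \<Rightarrow>\<^sub>0 nat) \<Rightarrow> ('a, 'k::field) mpoly" where
  "monom t = Poly_Mapping.single t 1"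

lemma monomials_eq: "monomials = range monom"
  unfolding monomials_def monom_def ..

lemma monom_in_monomials [simp]: "monom t \<in> monomials"
  by (simp add: monomials_eq)

lemma monom_add: "monom (s + t) = monom s * monom t"
  by (simp add: monom_def mult_single)

lemma monom_0: "monom 0 = 1"
  by (simp add: monom_def)

lemma monom_sum: "monom (\<Sum>i\<in>I. t i) = (\<Prod>i\<in>I. monom (t i))"
  by (induction I rule: infinite_finite_induct) (simp_all add: monom_0 monom_add)

lemma keys_mult_monom:
  assumes "t \<in> Poly_Mapping.keys (q * monom s :: ('a, 'k::field) mpoly)"
  shows "\<exists>u. t = u + s"
  using assms keys_mult[of q "monom s"] by (auto simp: monom_def)

lemma monom_dvd_monom_iff:
  "(monom s :: ('a, 'k::field) mpoly) dvd monom t \<longleftrightarrow>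
    (\<forall>v. Poly_Mapping.lookup s v \<le> Poly_Mapping.lookup t v)"
proof
  assume "(monom s :: ('a, 'k) mpoly) dvd monom t"
  then obtain q :: "('a, 'k) mpoly" where "monom t = q * monom s"
    by (metis dvdE mult.commute)
  then have "t \<in> Poly_Mapping.keys (q * monom s)"
    by (metis keys_single monom_def one_neq_zero singletonI)
  then obtain u where "t = u + s"
    using keys_mult_monom by blast
  then show "\<forall>v. Poly_Mapping.lookup s v \<le> Poly_Mapping.lookup t v"
    by (simp add: lookup_add)
next
  assume "\<forall>v. Poly_Mapping.lookup s v \<le> Poly_Mapping.lookup t v"
  \<comment> \<open>Subtraction of exponents is truncated; the assumed inequality makes it
    exact.\<close>
  then have "t = s + (t - s)"
    by (intro poly_mapping_eqI) (simp add: lookup_add lookup_minus)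
  then show "(monom s :: ('a, 'k) mpoly) dvd monom t"
    by (metis monom_add dvd_triv_left)
qed

lemma monomials_dvd_antisym:
  assumes "m \<in> monomials" "m' \<in> monomials" "m dvd m'" "m' dvd m"
  shows "m = m'"
proof -
  obtain s t where st: "m = monom s" "m' = monom t"
    using assms(1,2) by (auto simp: monomials_eq)
  then have "s = t"
    using assms(3,4) by (intro poly_mapping_eqI le_antisym) (auto simp: monom_dvd_monom_iff)
  then show ?thesis
    using st by simp
qed

section \<open>Least common multiples and greatest common divisors of monomials\<close>

lemma lookup_Abs_finite [simp]:
  fixes e :: "'a::finite \<Rightarrow> nat"
  shows "Poly_Mapping.lookup (Abs_poly_mapping e) = e"
  by (rule lookup_Abs_poly_mapping) simp

text \<open>Each variable gets its maximal exponent. Inserting 0 keeps \<open>Max\<close> meaningful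
  for empty \<open>I\<close>, where the lcm is 1.\<close>

lemma mlcm_monom_image:
  fixes e :: "'i \<Rightarrow> ('a::finite \<Rightarrow>\<^sub>0 nat)"
  assumes "finite I"
  shows "mlcm ((\<lambda>i. monom (e i) :: ('a, 'k::field) mpoly) ` I) =
    monom (Abs_poly_mapping (\<lambda>v. Max (insert 0 ((\<lambda>i. Poly_Mapping.lookup (e i) v) ` I))))"
    (is "mlcm ?M = ?m")
proof -
  have up: "\<forall>p\<in>?M. p dvd ?m"
    using assms by (simp add: monom_dvd_monom_iff)
  have least: "\<forall>m'\<in>monomials. (\<forall>p\<in>?M. p dvd m') \<longrightarrow> ?m dvd m'"
    using assms by (auto simp: monomials_eq monom_dvd_monom_iff)
  show ?thesis
    unfolding mlcm_def
  proof (rule the_equality)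
    fix m :: "('a, 'k) mpoly"
    assume "m \<in> monomials \<and> (\<forall>p\<in>?M. p dvd m) \<and>
      (\<forall>m'\<in>monomials. (\<forall>p\<in>?M. p dvd m') \<longrightarrow> m dvd m')"
    then show "m = ?m"
      using up least by (intro monomials_dvd_antisym) auto
  qed (use up least in simp)
qed

text \<open>A finite maximum is attained, so divisibility is tested one variable at a time, with an
  index that may depend on the variable.\<close>

lemma monom_dvd_mlcm_iff:
  fixes e :: "'i \<Rightarrow> ('a::finite \<Rightarrow>\<^sub>0 nat)"
  assumes "finite I"
  shows "monom s dvd mlcm ((\<lambda>i. monom (e i) :: ('a, 'k::field) mpoly) ` I) \<longleftrightarrow>
    (\<forall>v. Poly_Mapping.lookup s v = 0 \<or>
      (\<exists>i\<in>I. Poly_Mapping.lookup s v \<le> Poly_Mapping.lookup (e i) v))"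
  using assms by (simp add: mlcm_monom_image monom_dvd_monom_iff Max_ge_iff)

lemma mlcm_in_monomials:
  fixes M :: "('a::finite, 'k::field) mpoly set"
  assumes "finite M" "M \<subseteq> monomials"
  shows "mlcm M \<in> monomials"
proof -
  obtain T where "finite T" "M = monom ` T"
    using assms finite_subset_image by (metis monomials_eq)
  then show ?thesis
    using mlcm_monom_image[where 'k = 'k, of T "\<lambda>t. t"] by simp
qed

lemma mlcm_dvd_iff:
  fixes M :: "('a::finite, 'k::field) mpoly set"
  assumes "finite M" "M \<subseteq> monomials" "m \<in> monomials"
  shows "mlcm M dvd m \<longleftrightarrow> (\<forall>p\<in>M. p dvd m)"
proof -
  obtain T where T: "finite T" "M = monom ` T"
    using assms finite_subset_image by (metis monomials_eq)
  obtain s where "m = monom s"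
    using assms by (auto simp: monomials_eq)
  then show ?thesis
    using T mlcm_monom_image[where 'k = 'k, of T "\<lambda>t. t"] by (auto simp: monom_dvd_monom_iff)
qed

lemma dvd_mlcm:
  fixes M :: "('a::finite, 'k::field) mpoly set"
  assumes "finite M" "M \<subseteq> monomials" "p \<in> M"
  shows "p dvd mlcm M"
  using mlcm_dvd_iff[OF assms(1,2) mlcm_in_monomials[OF assms(1,2)]] assms(3) by simp

text \<open>The gcd divides the member \<open>m\<close> anyway, so equality only asks that
  \<open>m\<close> be a common divisor.\<close>

lemma mgcd_eq_iff:
  fixes M :: "('a::finite, 'k::field) mpoly set"
  assumes fin: "finite M" and M: "M \<subseteq> monomials" and m: "m \<in> M"
  shows "mgcd M = m \<longleftrightarrow> (\<forall>p\<in>M. m dvd p)"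
proof -
  let ?gcd = "\<lambda>m. m \<in> monomials \<and> (\<forall>p\<in>M. m dvd p) \<and>
    (\<forall>m'\<in>monomials. (\<forall>p\<in>M. m' dvd p) \<longrightarrow> m' dvd m)"
  have mgcd: "mgcd M = (THE m. ?gcd m)"
    using m by (auto simp: mgcd_def)
  have uniq: "mgcd M = d" if "?gcd d" for d
    unfolding mgcd by (rule the_equality) (use that monomials_dvd_antisym in blast)+
  obtain T where T: "finite T" "M = monom ` T"
    using fin M finite_subset_image by (metis monomials_eq)
  have "T \<noteq> {}"
    using T m by auto
  \<comment> \<open>Minimal exponents show that a gcd exists, so the description in
    \<open>mgcd\<close> denotes; \<open>Min\<close> needs \<open>T\<close> nonempty.\<close>
  then have "?gcd (monom (Abs_poly_mapping (\<lambda>v. Min ((\<lambda>t. Poly_Mapping.lookup t v) ` T))))"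
    using T by (auto simp: monomials_eq monom_dvd_monom_iff)
  then have "?gcd (mgcd M)"
    using uniq by metis
  moreover have "mgcd M = m" if "\<forall>p\<in>M. m dvd p"
    using that m M by (intro uniq) auto
  ultimately show ?thesis by auto
qed

section \<open>Minimal generators of monomial ideals\<close>

interpretation ring_module: module "(*) :: 'r::comm_ring_1 \<Rightarrow> 'r \<Rightarrow> 'r"
  by unfold_locales (simp_all add: algebra_simps)

text \<open>By induction on linear combinations, every exponent vector in the support of an ideal
  element lies above that of some generator; a monomial is its own support.\<close>

lemma monomial_in_ideal_generatedD:
  fixes G :: "('a, 'k::field) mpoly set"
  assumes G: "G \<subseteq> monomials" and m: "m \<in> monomials" "m \<in> ideal_generated G"
  shows "\<exists>g\<in>G. g dvd m"
proof -
  have "\<exists>s u. monom s \<in> G \<and> t = u + s"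
    if "f \<in> ring_module.span G" "t \<in> Poly_Mapping.keys f" for f :: "('a, 'k) mpoly" and t
    using that
  proof (induction arbitrary: t rule: ring_module.span_induct_alt)
    case base
    then show ?case by simp
  next
    case (step c x y)
    have "t \<in> Poly_Mapping.keys (c * x) \<or> t \<in> Poly_Mapping.keys y"
      using step.prems keys_add[of "c * x" y] by blast
    then show ?case
    proof
      assume t: "t \<in> Poly_Mapping.keys (c * x)"
      obtain s where "x = monom s"
        using step.hyps G by (auto simp: monomials_eq)
      then show ?thesis
        using t step.hyps keys_mult_monom by blast
    qed (rule step.IH)
  qed
  moreover obtain t where t: "m = monom t"
    using m by (auto simp: monomials_eq)
  moreover have "t \<in> Poly_Mapping.keys (monom t :: ('a, 'k) mpoly)"
    by (simp add: monom_def)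
  ultimately obtain s u where "monom s \<in> G" "t = u + s"
    using m(2) unfolding ideal_generated_def by blast
  then show ?thesis
    using t monom_add[of u s] by (metis dvd_triv_right)
qed

text \<open>For a rival irredundant \<open>G\<close>, each \<open>x\<close> in \<open>X\<close> has
  a divisor \<open>g\<close> in \<open>G\<close>, which has a divisor \<open>y\<close> in
  \<open>X\<close>. The antichain condition collapses all three, so \<open>X\<close> lies in
  \<open>G\<close>, and irredundancy of \<open>G\<close> forces equality.\<close>

lemma minimal_generators_antichain:
  fixes X :: "('a, 'k::field) mpoly set"
  assumes X: "X \<subseteq> monomials"
    and antichain: "\<And>x y. x \<in> X \<Longrightarrow> y \<in> X \<Longrightarrow> x dvd y \<Longrightarrow> x = y"
  shows "minimal_generators (ideal_generated X) = X"
  unfolding minimal_generators_def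
proof (rule the_equality)
  have sub: "Y \<subseteq> ideal_generated Y" for Y :: "('a, 'k) mpoly set"
    unfolding ideal_generated_def by (rule ring_module.span_superset)
  have "ideal_generated H \<noteq> ideal_generated X" if H: "H \<subset> X" for H
  proof
    assume eq: "ideal_generated H = ideal_generated X"
    obtain x where x: "x \<in> X" "x \<notin> H"
      using H by blast
    then have "x \<in> ideal_generated H"
      using eq sub[of X] by auto
    moreover have "H \<subseteq> monomials" "x \<in> monomials"
      using H X x by auto
    ultimately obtain h where "h \<in> H" "h dvd x"
      using monomial_in_ideal_generatedD by metis
    then show False
      using antichain[of h x] x H by blast
  qed
  then show "X \<subseteq> monomials \<and> ideal_generated X = ideal_generated X \<and>
      (\<forall>H. H \<subset> X \<longrightarrow> ideal_generated H \<noteq> ideal_generated X)"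
    using X by blast
  fix G :: "('a, 'k) mpoly set"
  assume "G \<subseteq> monomials \<and> ideal_generated G = ideal_generated X \<and>
    (\<forall>H. H \<subset> G \<longrightarrow> ideal_generated H \<noteq> ideal_generated X)"
  then have G: "G \<subseteq> monomials" "ideal_generated G = ideal_generated X"
    "\<And>H. H \<subset> G \<Longrightarrow> ideal_generated H \<noteq> ideal_generated G"
    by auto
  have XG: "\<exists>g\<in>G. g dvd x" if "x \<in> X" for x
    using monomial_in_ideal_generatedD[OF G(1)] subsetD[OF X that] subsetD[OF sub that] G(2)
    by simp
  have GX: "\<exists>x\<in>X. x dvd g" if "g \<in> G" for g
    using monomial_in_ideal_generatedD[OF X] subsetD[OF G(1) that] subsetD[OF sub that] G(2)
    by simp
  have "X \<subseteq> G"
  proof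
    fix x assume x: "x \<in> X"
    then obtain g where g: "g \<in> G" "g dvd x"
      using XG by blast
    then obtain y where y: "y \<in> X" "y dvd g"
      using GX by blast
    then have "y = x"
      using antichain x g(2) dvd_trans by blast
    then have "g = x"
      using g y x X G(1) by (intro monomials_dvd_antisym) auto
    then show "x \<in> G"
      using g by simp
  qed
  then show "G = X"
    using G(2) G(3)[of X] by auto
qed

section \<open>The labeling\<close>

definition x_exp :: "'a::finite set set \<Rightarrow> 'a \<Rightarrow> ('a \<Rightarrow>\<^sub>0 nat)" where
  "x_exp S a = Abs_poly_mapping (\<lambda>v. card {C \<in> S. v \<in> C \<and> a \<notin> C})"

lemma lookup_x_exp: "Poly_Mapping.lookup (x_exp S a) v = card {C \<in> S. v \<in> C \<and> a \<notin> C}"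
  by (simp add: x_exp_def)

text \<open>Double counting: each \<open>C\<close> avoiding \<open>a\<close> adds 1 to the exponent
  of each of its elements.\<close>

lemma x_mon_eq_monom: "x_mon S a = monom (x_exp S a)"
proof -
  let ?F = "{C \<in> S. \<not> {a} \<subseteq> C}"
  have var: "var v = monom (Poly_Mapping.single v 1)" for v
    by (simp add: var_def monom_def)
  have "x_mon S a = monom (\<Sum>C\<in>?F. \<Sum>v\<in>C. Poly_Mapping.single v 1)"
    unfolding x_mon_def label_def var monom_sum ..
  also have "(\<Sum>C\<in>?F. \<Sum>v\<in>C. Poly_Mapping.single v 1) = x_exp S a"
  proof (rule poly_mapping_eqI)
    fix v
    have "Poly_Mapping.lookup (\<Sum>C\<in>?F. \<Sum>v\<in>C. Poly_Mapping.single v 1) v =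
        (\<Sum>C\<in>?F. \<Sum>u\<in>C. if u = v then 1 else 0)"
      by (simp add: lookup_sum lookup_single when_def)
    also have "\<dots> = (\<Sum>C\<in>?F. if v \<in> C then 1 else 0)"
      by (simp)
    also have "\<dots> = card {C \<in> ?F. v \<in> C}"
      by (simp add: sum.If_cases Int_def)
    also have "{C \<in> ?F. v \<in> C} = {C \<in> S. v \<in> C \<and> a \<notin> C}"
      by auto
    finally show "Poly_Mapping.lookup (\<Sum>C\<in>?F. \<Sum>v\<in>C. Poly_Mapping.single v 1) v =
        Poly_Mapping.lookup (x_exp S a) v"
      by (simp add: lookup_x_exp)
  qed
  finally show ?thesis .
qed

lemma x_mon_in_monomials [simp]: "x_mon S a \<in> monomials"
  by (simp add: x_mon_eq_monom)

lemma x_mon_dvd_mlcm_iff: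
  "(x_mon S a :: ('a::finite, 'k::field) mpoly) dvd mlcm (x_mon S ` W) \<longleftrightarrow>
    (\<forall>v. Poly_Mapping.lookup (x_exp S a) v = 0 \<or>
      (\<exists>w\<in>W. Poly_Mapping.lookup (x_exp S a) v \<le> Poly_Mapping.lookup (x_exp S w) v))"
  unfolding x_mon_eq_monom by (rule monom_dvd_mlcm_iff) simp

lemma x_exp_pos:
  fixes S :: "'a::finite set set"
  assumes S: "S \<in> atomic_lattices" and "a \<noteq> b"
  shows "0 < Poly_Mapping.lookup (x_exp S a) b"
proof -
  have "{b} \<in> {C \<in> S. b \<in> C \<and> a \<notin> C}"
    using assms by (simp add: atomic_lattices_def)
  then show ?thesis
    by (auto simp: lookup_x_exp card_gt_0_iff)
qed

lemma x_mon_dvd_imp_eq: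
  assumes S: "S \<in> atomic_lattices"
    and dvd: "(x_mon S a :: ('a::finite, 'k::field) mpoly) dvd x_mon S b"
  shows "a = b"
proof (rule ccontr)
  assume "a \<noteq> b"
  then have "0 < Poly_Mapping.lookup (x_exp S a) b"
    by (rule x_exp_pos[OF S])
  moreover have "Poly_Mapping.lookup (x_exp S a) b \<le> Poly_Mapping.lookup (x_exp S b) b"
    using dvd by (simp add: x_mon_eq_monom monom_dvd_monom_iff)
  moreover have "Poly_Mapping.lookup (x_exp S b) b = 0"
    by (auto simp: lookup_x_exp card_eq_0_iff)
  ultimately show False
    by simp
qed

lemma LCM_lattice_coord_ideal:
  fixes S :: "'a::finite set set"
  assumes S: "S \<in> atomic_lattices"
  shows "LCM_lattice (coord_ideal S :: ('a, 'k::field) mpoly set) =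
    range (\<lambda>W. mlcm (x_mon S ` W))"
proof -
  have "minimal_generators (coord_ideal S :: ('a, 'k) mpoly set) = range (x_mon S)"
    unfolding coord_ideal_def
    by (rule minimal_generators_antichain) (use x_mon_dvd_imp_eq[OF S] in auto)
  moreover have "Pow (range (x_mon S :: 'a \<Rightarrow> ('a, 'k) mpoly)) = range (\<lambda>W. x_mon S ` W)"
    by (auto simp: subset_image_iff)
  ultimately show ?thesis
    by (simp add: LCM_lattice_def image_image)
qed

section \<open>The elements of the lcm-lattice and the condition on \<open>triangle\<close>\<close>

lemma mlcm_x_mon_dvd_iff:
  fixes m :: "('a::finite, 'k::field) mpoly"
  assumes "m \<in> monomials"
  shows "mlcm (x_mon S ` W) dvd m \<longleftrightarrow> (\<forall>w\<in>W. x_mon S w dvd m)"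
  using assms by (subst mlcm_dvd_iff) auto

lemma mlcm_x_mon_in_monomials [simp]: "mlcm (x_mon S ` W) \<in> monomials"
  by (rule mlcm_in_monomials) auto

lemma x_mon_dvd_mlcm: "w \<in> W \<Longrightarrow> x_mon S w dvd mlcm (x_mon S ` W)"
  by (rule dvd_mlcm) auto

lemma mlcm_x_mon_singleton: "mlcm {x_mon S a} = x_mon S a"
  using mlcm_x_mon_dvd_iff[of "x_mon S a" S "{a}"] x_mon_dvd_mlcm[of a "{a}" S]
    mlcm_x_mon_in_monomials[of S "{a}"]
  by (intro monomials_dvd_antisym) auto

text \<open>Each \<open>W\<close> belongs to exactly one \<open>D\<close>, its join, so the union
  over \<open>D\<close> collects the \<open>W\<close> with \<open>a\<close> in their join. Among
  them is \<open>{a}\<close>, which puts \<open>x_mon S a\<close> itself into the set whose gcd is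
  taken.\<close>

lemma triangle_eq_x_mon_iff:
  fixes S :: "'a::finite set set"
  assumes S: "S \<in> atomic_lattices"
  shows "triangle S a = (x_mon S a :: ('a, 'k::field) mpoly) \<longleftrightarrow>
    (\<forall>W. a \<in> Join S ((\<lambda>w. {w}) ` W) \<longrightarrow> x_mon S a dvd (mlcm (x_mon S ` W) :: ('a, 'k) mpoly))"
proof -
  have W: "(\<Union>D\<in>{D \<in> S. {a} \<subseteq> D}. join_sets S D) = {W. a \<in> Join S ((\<lambda>w. {w}) ` W)}"
  proof -
    have "W \<subseteq> Join S ((\<lambda>w. {w}) ` W)" for W
      using Union_subset_Join[of "(\<lambda>w. {w}) ` W" S] by simp
    then show ?thesis
      using Join_in[OF S] by (auto simp: join_sets_def)
  qed
  have "a \<in> Join S ((\<lambda>w. {w}) ` {a})"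
    using Union_subset_Join[of "{{a}}" S] by simp
  moreover have "x_mon S a = mlcm (x_mon S ` {a})"
    by (simp add: mlcm_x_mon_singleton)
  ultimately have "(x_mon S a :: ('a, 'k) mpoly) \<in>
      (\<lambda>W. mlcm (x_mon S ` W)) ` {W. a \<in> Join S ((\<lambda>w. {w}) ` W)}"
    by blast
  then show ?thesis
    unfolding triangle_def W by (subst mgcd_eq_iff) auto
qed

theorem theorem5p3:
  fixes R P Q :: "'a::finite set set"
  assumes "R \<in> atomic_lattices" and "P \<in> atomic_lattices" and "Q \<in> atomic_lattices"
    and "super_atomic R"
    and "lattice_covered Q P"
    and "lattice_le P R"
    and "strong_coordinatization TYPE('k::field) P"
  shows "strong_coordinatization TYPE('k) Q \<longleftrightarrow>
    (\<forall>a. triangle Q a = (x_mon Q a :: ('a, 'k) mpoly))"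
proof
  note Q = \<open>Q \<in> atomic_lattices\<close>
  let ?lcm = "\<lambda>W. mlcm (x_mon Q ` W) :: ('a, 'k) mpoly"
  {
    assume "strong_coordinatization TYPE('k) Q"
    then obtain g :: "'a set \<Rightarrow> ('a, 'k) mpoly"
      where iso: "lattice_iso Q (range ?lcm) g" and atom: "\<And>a. g {a} = x_mon Q a"
      unfolding strong_coordinatization_def LCM_lattice_coord_ideal[OF Q] by metis
    have bij: "bij_betw g Q (range ?lcm)"
      and ord: "\<And>A B. A \<in> Q \<Longrightarrow> B \<in> Q \<Longrightarrow> A \<subseteq> B \<longleftrightarrow> g A dvd g B"
      using iso unfolding lattice_iso_def by auto
    have sing: "{a} \<in> Q" for a
      using Q by (simp add: atomic_lattices_def)
    have "x_mon Q a dvd ?lcm W" if a: "a \<in> Join Q ((\<lambda>w. {w}) ` W)" for a W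
    proof -
      obtain D where D: "D \<in> Q" "g D = ?lcm W"
        using bij_betw_imp_surj_on[OF bij] by (metis imageE rangeI)
      \<comment> \<open>Reflecting divisibility through \<open>g\<close> puts all of
        \<open>W\<close>, hence its join and \<open>a\<close>, below the preimage \<open>D\<close>
        of the lcm.\<close>
      have "{w} \<subseteq> D" if "w \<in> W" for w
        using ord[OF sing D(1)] that x_mon_dvd_mlcm[of w W Q] by (simp add: atom D(2))
      then have "Join Q ((\<lambda>w. {w}) ` W) \<subseteq> D"
        using D(1) by (subst Join_subset_iff) auto
      then have "g {a} dvd g D"
        using a ord[OF sing D(1), of a] by auto
      then show ?thesis
        by (simp add: atom D(2))
    qed
    then show "\<forall>a. triangle Q a = (x_mon Q a :: ('a, 'k) mpoly)"
      using triangle_eq_x_mon_iff[OF Q] by blast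
  }
  assume "\<forall>a. triangle Q a = (x_mon Q a :: ('a, 'k) mpoly)"
  then have tri: "x_mon Q a dvd ?lcm W" if "a \<in> Join Q ((\<lambda>w. {w}) ` W)" for a W
    using triangle_eq_x_mon_iff[OF Q] that by blast
  have "Q \<subseteq> R" "Q \<noteq> P"
    using lattice_le_imp_subset assms unfolding lattice_covered_def lattice_less_def
    by (metis subset_trans)+
  \<comment> \<open>With a single label, \<open>x_mon Q a = 1\<close> satisfies the condition on \<open>triangle\<close>, but the lcm-lattice
    has only one element.\<close>
  have two: "\<exists>b. b \<noteq> a" for a :: 'a
  proof (rule ccontr)
    assume "\<nexists>b. b \<noteq> a"
    then have triv: "A = {} \<or> A = UNIV" for A :: "'a set"
      by (metis UNIV_eq_I equals0I)
    have "S = UNIV" if "S \<in> atomic_lattices" for S :: "'a set set"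
    proof -
      have "A \<in> S" for A
        using triv[of A] that by (auto simp: atomic_lattices_def)
      then show ?thesis by blast
    qed
    then have "Q = P"
      using assms(2,3) by metis
    then show False
      using \<open>Q \<noteq> P\<close> by blast
  qed
  have sep: "a \<in> D" if D: "D \<in> Q" and dvd: "x_mon Q a dvd ?lcm D" for a D
  proof (rule ccontr)
    assume a: "a \<notin> D"
    have exps: "Poly_Mapping.lookup (x_exp Q a) v = 0 \<or>
        (\<exists>w\<in>D. Poly_Mapping.lookup (x_exp Q a) v \<le> Poly_Mapping.lookup (x_exp Q w) v)" for v
      using dvd x_mon_dvd_mlcm_iff by blast
    show False
    proof (cases "D = {}")
      case True
      obtain b where "b \<noteq> a"
        using two by blast
      \<comment> \<open>The lcm over the empty set is 1, whereas \<open>b\<close> occurs in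
        \<open>x_mon Q a\<close>.\<close>
      then show False
        using exps[of b] x_exp_pos[OF Q, of a b] True by simp
    next
      case False
      obtain p where p: "p \<in> D" "\<And>C. C \<in> Q \<Longrightarrow> p \<in> C \<Longrightarrow> a \<in> C \<Longrightarrow> D \<subseteq> C"
        using super_atomic_separation[OF assms(1,4) subsetD[OF \<open>Q \<subseteq> R\<close> D] False a]
          subsetD[OF \<open>Q \<subseteq> R\<close>] by metis
      have less: "Poly_Mapping.lookup (x_exp Q w) p < Poly_Mapping.lookup (x_exp Q a) p"
        if "w \<in> D" for w
        unfolding lookup_x_exp
      proof (rule psubset_card_mono)
        \<comment> \<open>\<open>D\<close> makes the inclusion of the counted families strict. The
          inclusion holds because a \<open>C\<close> containing both \<open>p\<close> and
          \<open>a\<close> would contain \<open>D\<close> and so \<open>w\<close>.\<close>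
        have "D \<in> {C \<in> Q. p \<in> C \<and> a \<notin> C}" "D \<notin> {C \<in> Q. p \<in> C \<and> w \<notin> C}"
          using D p(1) a that by auto
        moreover have "{C \<in> Q. p \<in> C \<and> w \<notin> C} \<subseteq> {C \<in> Q. p \<in> C \<and> a \<notin> C}"
          using p(2) subsetD[OF _ that] by auto
        ultimately show "{C \<in> Q. p \<in> C \<and> w \<notin> C} \<subset> {C \<in> Q. p \<in> C \<and> a \<notin> C}"
          by blast
      qed simp
      show False
        \<comment> \<open>Strictness at \<open>w = p\<close> makes the exponent of \<open>p\<close>
          in \<open>x_mon Q a\<close> positive, which excludes the first alternative of
          \<open>exps\<close>.\<close>
        using exps[of p] less less[OF p(1)] by (metis leD not_less_zero)
    qed
  qed
  have ord: "A \<subseteq> B \<longleftrightarrow> ?lcm A dvd ?lcm B" if "A \<in> Q" "B \<in> Q" for A B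
    using sep[OF that(2)] x_mon_dvd_mlcm[of _ B Q] by (auto simp: mlcm_x_mon_dvd_iff)
  have "inj_on ?lcm Q"
    by (rule inj_onI) (use ord in \<open>metis dvd_refl subset_antisym\<close>)
  \<comment> \<open>Surjectivity: by \<open>tri\<close>, passing from \<open>W\<close> to its join
    leaves the lcm unchanged.\<close>
  moreover have "?lcm W \<in> ?lcm ` Q" for W
  proof
    let ?J = "Join Q ((\<lambda>w. {w}) ` W)"
    have "W \<subseteq> ?J"
      using Union_subset_Join[of "(\<lambda>w. {w}) ` W" Q] by auto
    then show "?lcm W = ?lcm ?J"
      using tri x_mon_dvd_mlcm[of _ ?J Q]
      by (intro monomials_dvd_antisym) (auto simp: mlcm_x_mon_dvd_iff)
    show "?J \<in> Q"
      by (rule Join_in[OF Q])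
  qed
  ultimately have "bij_betw ?lcm Q (range ?lcm)"
    unfolding bij_betw_def by blast
  then have "lattice_iso Q (LCM_lattice (coord_ideal Q)) ?lcm"
    unfolding lattice_iso_def LCM_lattice_coord_ideal[OF Q] using ord by blast
  then show "strong_coordinatization TYPE('k) Q"
    unfolding strong_coordinatization_def
    by (intro exI[of _ ?lcm]) (simp add: mlcm_x_mon_singleton)
qed

end
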